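(* Let $(a_{jk})_{j,k\in\mathbb{N}}$ be a family of elements of $\mathbb{F}$ with $a_{0k}=a_{1k}=:a_k$ for all $k\in\mathbb{N}$ and $a_0\ne0$, and let $\mathbf{E}\colon\mathbb{F}[x_0]\to\mathbb{F}$ be the linear functional with $\mathbf{E}\,x_0^k=a_k$ for all $k\in\mathbb{N}$. (1) The set $\{p_{nm}(x_0)\mid 1\le m\le n\}$ of polynomials defined by the determinants of order $n+1$ $$p_{nm}(x_0)=\begin{vmatrix} 1&x_0&x_0^2&\cdots&x_0^n\\ a_{0}&a_{1}&a_{2}&\cdots&a_{n}\\ a_{1}&a_{2}&a_{3}&\cdots&a_{n+1}\\ \vdots&\vdots&\vdots&&\vdots\\ a_{n-m}&a_{n-m+1}&a_{n-m+2}&\cdots&a_{2n-m}\\ a_{2\,0}&a_{2\,1}&a_{2\,2}&\cdots&a_{2\,n}\\ \vdots&\vdots&\vdots&&\vdots\\ a_{m\,0}&a_{m\,1}&a_{m\,2}&\cdots&a_{m\,n} \end{vmatrix}$$ is a generalized orthogonal polynomial system for $\mathbf{E}$, provided that $\deg p_{nm}=n$ for all $1\leq m\leq n$. (2) Equivalently, the set $\{p_{nm}(x_0)\mid 1\le m\le n\}$ of polynomials defined by $$p_{nm}(x_0)=\mathbf{E}_0\,\Delta(x_1,x_2,\ldots,x_{n-m+1})\,\Delta(x_0,x_1,\ldots,x_n),$$ where, for each $(n,m)$, the indices are assigned to classes so that $1,2,\ldots,n-m+1\in\mathbb{P}_1$, $n-m+2\in\mathbb{P}_2$, $\ldots$,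 $n\in\mathbb{P}_m$, is a generalized orthogonal polynomial system for $\mathbf{E}$, provided that $\deg p_{nm}=n$ for all $1\leq m\leq n$.
   Context: $\mathbb{F}$ is a field of characteristic zero; $\mathbb{N}$ and $\mathbb{P}$ are the sets of nonnegative and positive integers. $x_0,x_1,x_2,\ldots$ are independent indeterminates. Generalized orthogonal polynomial system: for a linear functional $\mathbf{E}\colon\mathbb{F}[x_0]\to\mathbb{F}$ with $\mathbf{E}\,1\ne0$, a set $\{p_{nm}(x_0)\mid n,m\in\mathbb{P},\,1\le m\le n\}$ of polynomials with $\deg p_{nm}=n$ for all $1\le m\le n$ is a generalized orthogonal polynomial system for $\mathbf{E}$ if for all $1\le m\le n$ $$\mathbf{E}\,x_0^k\,p_{nm}(x_0)=0\quad\text{for all }0\le k\le n-m.$$ Vandermonde polynomial: $\Delta(x_1,\ldots,x_N)=\prod_{1\le i<j\le N}(x_j-x_i)$, with $\Delta(x_1)=1$; similarly $\Delta(x_0,x_1,\ldots,x_n)=\prod_{0\le i<j\le n}(x_j-x_i)$. Operator $\mathbf{E}_0$: positive integers are divided into pairwise disjoint classes $\mathbb{P}_0,\mathbb{P}_1,\mathbb{P}_2,\ldots$, and an indeterminate $x_i$ with $i\in\mathbb{P}_j$ has $k$th moment $a_{jk}$. On polynomials in $x_0,x_1,\ldots,x_n$, $\mathbf{E}_0$ is the linear map into $\mathbb{F}[x_0]$ given by $\mathbf{E}_0\,x_0^{k_0}x_1^{k_1}\cdots x_n^{k_n}=x_0^{k_0}\prod_{i=1}^n a_{j(i)\,k_i}$,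 where $j(i)$ is the index with $i\in\mathbb{P}_{j(i)}$ (exponents $k_i=0$ contribute $a_{j(i)\,0}$). With the class assignment for the pair $(n,m)$ in the claim, $j(i)=1$ for $1\le i\le n-m+1$ and $j(i)=i-(n-m)$ for $n-m+2\le i\le n$. In the determinant the rows are: $(x_0^c)_{0\le c\le n}$; the $n-m+1$ rows $(a_{k+c})_{0\le c\le n}$ for $k=0,\ldots,n-m$; and the $m-1$ rows $(a_{j\,c})_{0\le c\le n}$ for $j=2,\ldots,m$. *)

theory Defs
  imports
    "HOL-Library.Poly_Mapping"
    "HOL-Computational_Algebra.Polynomial"
    "Jordan_Normal_Form.Determinant"
begin

text \<open>
  \<open>p n m\<close> is only constrained for \<open>1 \<le> m \<le> n\<close>. Since \<open>n \<ge> 1\<close> there,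
  \<open>degree (p n m) = n\<close> excludes the zero polynomial.
\<close>

definition gen_orthogonal_system :: "('a::field poly \<Rightarrow> 'a) \<Rightarrow> (nat \<Rightarrow> nat \<Rightarrow> 'a poly) \<Rightarrow> bool" where
  "gen_orthogonal_system E p \<longleftrightarrow>
     Vector_Spaces.linear smult (*) E \<and> E 1 \<noteq> 0 \<and>
     (\<forall>n m. 1 \<le> m \<and> m \<le> n \<longrightarrow>
        degree (p n m) = n \<and> (\<forall>k\<le>n - m. E (monom 1 k * p n m) = 0))"

text \<open>
  Row \<open>0\<close> consists of the powers of the indeterminate; row \<open>r\<close> with
  \<open>1 \<le> r \<le> n - m + 1\<close> is the row of shifted moments for \<open>k = r - 1\<close>; row \<open>r\<close> with
  \<open>n - m + 2 \<le> r \<le> n\<close> is the row of moments of class \<open>j = r - (n - m)\<close>, running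
  over \<open>2, \<dots>, m\<close>.
\<close>

definition moment_matrix :: "(nat \<Rightarrow> nat \<Rightarrow> 'a::comm_ring_1) \<Rightarrow> nat \<Rightarrow> nat \<Rightarrow> 'a poly mat" where
  "moment_matrix a n m = mat (n + 1) (n + 1) (\<lambda>(r, c).
     if r = 0 then monom 1 c
     else if r \<le> n - m + 1 then [:a 1 (r - 1 + c):]
     else [:a (r - (n - m)) c:])"

definition det_poly :: "(nat \<Rightarrow> nat \<Rightarrow> 'a::comm_ring_1) \<Rightarrow> nat \<Rightarrow> nat \<Rightarrow> 'a poly" where
  "det_poly a n m = det (moment_matrix a n m)"

text \<open>
  Polynomials in the indeterminates \<open>x\<^sub>0, x\<^sub>1, x\<^sub>2, \<dots>\<close>: finitely supported maps from
  exponent vectors to coefficients, with convolution as multiplication.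
\<close>

type_synonym 'a mpolynomial = "(nat \<Rightarrow>\<^sub>0 nat) \<Rightarrow>\<^sub>0 'a"

definition indet :: "nat \<Rightarrow> 'a::comm_ring_1 mpolynomial" where
  "indet i = Poly_Mapping.single (Poly_Mapping.single i 1) 1"

definition vandermonde :: "(nat \<Rightarrow> 'b::comm_ring_1) \<Rightarrow> nat \<Rightarrow> nat \<Rightarrow> 'b" where
  "vandermonde x l h = (\<Prod>j = l..h. \<Prod>i = l..<j. x j - x i)"

text \<open>
  The operator on polynomials in \<open>x\<^sub>0, \<dots>, x\<^sub>n\<close>, where \<open>cls i\<close> is the class of the index
  \<open>i\<close> and \<open>a j k\<close> the \<open>k\<close>-th moment of class \<open>j\<close>. It depends on \<open>n\<close>, since an
  indeterminate \<open>x\<^sub>i\<close> with \<open>1 \<le> i \<le> n\<close> absent from a monomial contributes \<open>a (cls i) 0\<close>.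
\<close>

definition E0 ::
    "(nat \<Rightarrow> nat \<Rightarrow> 'a::comm_ring_1) \<Rightarrow> (nat \<Rightarrow> nat) \<Rightarrow> nat \<Rightarrow> 'a mpolynomial \<Rightarrow> 'a poly" where
  "E0 a cls n f = (\<Sum>e\<in>Poly_Mapping.keys f.
     monom (Poly_Mapping.lookup f e * (\<Prod>i = 1..n. a (cls i) (Poly_Mapping.lookup e i)))
           (Poly_Mapping.lookup e 0))"

definition umbral_poly ::
    "(nat \<Rightarrow> nat \<Rightarrow> 'a::comm_ring_1) \<Rightarrow> (nat \<Rightarrow> nat) \<Rightarrow> nat \<Rightarrow> nat \<Rightarrow> 'a poly" where
  "umbral_poly a cls n m =
     E0 a cls n (vandermonde indet 1 (n - m + 1) * vandermonde indet 0 n)"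

end

theory Submission
  imports Defs
begin

text \<open>
  The determinant \<open>det_poly a n m\<close> contains the indeterminate \<open>x\<^sub>0\<close> only in its first row
  \<open>1, x\<^sub>0, \<dots>, x\<^sub>0\<^sup>n\<close>. Multiplying by \<open>x\<^sub>0\<^sup>k\<close> and applying the functional \<open>E\<close> therefore replaces this
  row by the moments \<open>a\<^sub>k, a\<^sub>k\<^sub>+\<^sub>1, \<dots>, a\<^sub>k\<^sub>+\<^sub>n\<close>. For \<open>k \<le> n - m\<close> this is also another row of the
  matrix, so the result vanishes (\<open>det_poly_orthogonal\<close>).

  The umbral polynomial is a multiple of that determinant. Expanding
  \<open>\<Delta>(x\<^sub>0, \<dots>, x\<^sub>n)\<close> by the Leibniz formula and applying \<open>E0\<close> would give the determinant whose
  rows are the powers of \<open>x\<^sub>0\<close> and the unshifted moments of the classes of \<open>x\<^sub>1, \<dots>, x\<^sub>n\<close>. A further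
  monomial factor in \<open>x\<^sub>1, \<dots>, x\<^sub>N\<close>, where \<open>N = n - m + 1\<close>, shifts the moments in the rows
  \<open>1, \<dots>, N\<close> by its exponents. The terms of
  \<open>\<Delta>(x\<^sub>1, \<dots>, x\<^sub>N)\<close> shift them by a permutation of \<open>0, \<dots>, N - 1\<close>, carrying the sign of this
  permutation. So each term yields the moment matrix with permuted rows, the two signs cancel,
  and the sum of the \<open>N!\<close> equal terms is \<open>N!\<close> times the determinant
  (\<open>umbral_poly_eq_fact_smult_det_poly\<close>). Orthogonality passes to this
  multiple, and in characteristic zero \<open>N!\<close> is not zero.
\<close>

section \<open>The Vandermonde determinant\<close>

text \<open>The Newton basis polynomial of degree \<open>c\<close> with nodes \<open>x\<^sub>0, x\<^sub>1, \<dots>\<close>.\<close>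

definition newton_poly :: "(nat \<Rightarrow> 'b::comm_ring_1) \<Rightarrow> nat \<Rightarrow> 'b poly" where
  "newton_poly x c = (\<Prod>t<c. [:- x t, 1:])"

text \<open>
  Monicity of degree \<open>c\<close>, put in terms of coefficients because these are the entries of the
  matrix that passes from powers to Newton polynomials.
\<close>

lemma coeff_newton_poly_ge: "c \<le> k \<Longrightarrow> coeff (newton_poly x c) k = (if k = c then 1 else 0)"
proof (induction c arbitrary: k)
  case 0
  then show ?case by (simp add: newton_poly_def)
next
  case (Suc c)
  then obtain k' where k: "k = Suc k'" "c \<le> k'" by (cases k) auto
  have "newton_poly x (Suc c) = smult (- x c) (newton_poly x c) + pCons 0 (newton_poly x c)"
    by (simp add: newton_poly_def mult.commute)
  then show ?case using Suc.IH[of k] Suc.IH[of k'] k by simp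
qed

lemma poly_newton_poly: "poly (newton_poly x c) y = (\<Prod>t<c. y - x t)"
  by (simp add: newton_poly_def poly_prod)

lemma poly_newton_poly_eq_sum:
  assumes "c < N"
  shows "poly (newton_poly x c) y = (\<Sum>k<N. y ^ k * coeff (newton_poly x c) k)"
proof -
  have "degree (newton_poly x c) \<le> c"
    by (intro degree_le) (auto simp: coeff_newton_poly_ge)
  then have "(\<Sum>k\<le>degree (newton_poly x c). coeff (newton_poly x c) k * y ^ k) =
      (\<Sum>k<N. coeff (newton_poly x c) k * y ^ k)"
    using assms by (intro sum.mono_neutral_left) (auto simp: coeff_eq_0)
  then show ?thesis by (simp add: poly_altdef mult.commute)
qed

text \<open>
  Passing from the basis of powers to the Newton basis is a unitriangular change of basis,
  so it does not affect the determinant. It turns the matrix of powers into the triangular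
  matrix of the values of the Newton polynomials at the nodes, and the diagonal of that matrix
  consists of the products of \<open>x\<^sub>j - x\<^sub>i\<close> over \<open>i < j\<close>, one for each \<open>j\<close>. The argument needs no division,
  so that it applies to the ring of polynomials in the indeterminates.
\<close>

lemma det_vandermonde:
  "det (mat (Suc n) (Suc n) (\<lambda>(i, j). x i ^ j)) = vandermonde x 0 n"
proof -
  define N where "N = Suc n"
  define V where "V = mat N N (\<lambda>(i, j). x i ^ j)"
  define U where "U = mat N N (\<lambda>(k, c). coeff (newton_poly x c) k)"
  define L where "L = mat N N (\<lambda>(i, c). \<Prod>t<c. x i - x t)"
  have VU: "V * U = L"
  proof (rule eq_matI)
    fix i c assume "i < dim_row L" "c < dim_col L"
    then have ic: "i < N" "c < N" by (auto simp: L_def)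
    show "(V * U) $$ (i, c) = L $$ (i, c)"
      using ic poly_newton_poly_eq_sum[of c N x "x i"]
      by (simp add: V_def U_def L_def scalar_prod_def poly_newton_poly atLeast0LessThan)
  qed (auto simp: V_def U_def L_def)
  have "det U = prod_list (diag_mat U)"
    by (rule det_upper_triangular[of _ N])
       (auto simp: upper_triangular_def U_def coeff_newton_poly_ge)
  also have "diag_mat U = map (\<lambda>i. 1) [0..<N]"
    by (auto simp: diag_mat_def U_def coeff_newton_poly_ge)
  finally have U: "det U = 1" by (simp add: prod_list_replicate map_replicate_const)
  have "det L = prod_list (diag_mat L)"
    by (rule det_lower_triangular[of N]) (auto simp: L_def intro!: prod_zero)
  also have "diag_mat L = map (\<lambda>i. \<Prod>t<i. x i - x t) [0..<N]"
    by (auto simp: diag_mat_def L_def)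
  also have "prod_list \<dots> = (\<Prod>i<N. \<Prod>t<i. x i - x t)"
    by (simp add: prod.distinct_set_conv_list[symmetric] atLeast0LessThan)
  also have "\<dots> = vandermonde x 0 n"
    by (simp add: vandermonde_def N_def lessThan_Suc_atMost atLeast0LessThan atLeast0AtMost)
  finally have "det L = vandermonde x 0 n" .
  moreover have "det L = det V * det U"
    unfolding VU[symmetric] by (rule det_mult[of _ N]) (auto simp: V_def U_def)
  ultimately show ?thesis by (simp add: U V_def N_def)
qed

lemma vandermonde_shift: "vandermonde x l (l + n) = vandermonde (\<lambda>i. x (l + i)) 0 n"
proof -
  have inner: "(\<Prod>i = l..<j + l. x (j + l) - x i) = (\<Prod>i = 0..<j. x (l + j) - x (l + i))" for j
    using prod.shift_bounds_nat_ivl[of "\<lambda>i. x (j + l) - x i" 0 l j]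
    by (simp add: add.commute)
  have "vandermonde x l (l + n) = (\<Prod>j = 0 + l..n + l. \<Prod>i = l..<j. x j - x i)"
    by (simp add: vandermonde_def add.commute)
  also have "\<dots> = (\<Prod>j = 0..n. \<Prod>i = l..<j + l. x (j + l) - x i)"
    by (rule prod.shift_bounds_cl_nat_ivl)
  also have "\<dots> = vandermonde (\<lambda>i. x (l + i)) 0 n"
    unfolding vandermonde_def by (intro prod.cong refl inner)
  finally show ?thesis .
qed

text \<open>
  The Leibniz formula for \<open>det_vandermonde\<close>. It is phrased with permutations of the index set
  \<open>{l..h}\<close> itself, since the permutations coming from \<open>\<Delta>(x\<^sub>1, \<dots>, x\<^sub>N)\<close> later
  permute the rows \<open>1, \<dots>, N\<close> of the moment matrix.
\<close>

lemma vandermonde_expansion: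
  fixes x :: "nat \<Rightarrow> 'b::comm_ring_1"
  assumes "l \<le> h"
  shows "vandermonde x l h =
    (\<Sum>p | p permutes {l..h}. of_int (sign p) * (\<Prod>i = l..h. x i ^ (p i - l)))"
proof -
  define n where "n = h - l"
  have h: "h = l + n" using assms by (simp add: n_def)
  let ?A = "{0..<Suc n}" and ?B = "{l..h}"
  let ?f = "\<lambda>i. l + i" and ?g = "\<lambda>i. i - l"
  have f: "bij_betw ?f ?A ?B"
    by (rule bij_betwI[of _ _ _ ?g]) (auto simp: h)
  have g: "bij_betw ?g ?B ?A"
    by (rule bij_betwI[of _ _ _ ?f]) (auto simp: h)
  have fi: "inj_on ?f ?A" by (auto simp: inj_on_def)
  have "vandermonde x l h = det (mat (Suc n) (Suc n) (\<lambda>(i, j). x (l + i) ^ j))"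
    by (simp add: det_vandermonde h vandermonde_shift)
  also have "\<dots> = (\<Sum>p | p permutes ?A. of_int (sign p) * (\<Prod>i\<in>?A. x (l + i) ^ p i))"
  proof (subst det_def'[of _ "Suc n"], simp, intro sum.cong refl arg_cong2[of _ _ _ _ "(*)"] prod.cong)
    fix p i assume "p \<in> {p. p permutes ?A}" "i \<in> ?A"
    then show "mat (Suc n) (Suc n) (\<lambda>(i, j). x (l + i) ^ j) $$ (i, p i) = x (l + i) ^ p i"
      using permutes_in_image[of p ?A i] by simp
  qed
  also have "\<dots> = (\<Sum>p | p permutes ?B. of_int (sign p) * (\<Prod>i\<in>?B. x i ^ (p i - l)))"
  proof (rule sum.reindex_bij_witness[of _ "map_permutation ?B ?g" "map_permutation ?A ?f"])
    fix p assume "p \<in> {p. p permutes ?A}"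
    then have p: "p permutes ?A" by simp
    show "map_permutation ?B ?g (map_permutation ?A ?f p) = p"
      by (rule map_permutation_compose_inv[OF f p]) simp
    show "map_permutation ?A ?f p \<in> {p. p permutes ?B}"
      using map_permutation_permutes[OF f p] by simp
    have "(\<Prod>i\<in>?B. x i ^ (map_permutation ?A ?f p i - l))
        = (\<Prod>i\<in>?A. x (?f i) ^ (map_permutation ?A ?f p (?f i) - l))"
      using prod.reindex_bij_betw[OF f, of "\<lambda>i. x i ^ (map_permutation ?A ?f p i - l)"] by simp
    also have "\<dots> = (\<Prod>i\<in>?A. x (l + i) ^ p i)"
      by (intro prod.cong refl) (simp add: map_permutation_apply[OF fi])
    finally show "of_int (sign (map_permutation ?A ?f p)) *
        (\<Prod>i\<in>?B. x i ^ (map_permutation ?A ?f p i - l)) =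
        (of_int (sign p) * (\<Prod>i\<in>?A. x (l + i) ^ p i) :: 'b)"
      by (simp add: sign_map_permutation[OF fi p])
  next
    fix p assume "p \<in> {p. p permutes ?B}"
    then have p: "p permutes ?B" by simp
    show "map_permutation ?A ?f (map_permutation ?B ?g p) = p"
      by (rule map_permutation_compose_inv[OF g p]) simp
    show "map_permutation ?B ?g p \<in> {p. p permutes ?A}"
      using map_permutation_permutes[OF g p] by simp
  qed
  finally show ?thesis .
qed

section \<open>Determinants with one row of powers\<close>

lemma prod_const_poly: "(\<Prod>i\<in>I. [:f i:]) = [:\<Prod>i\<in>I. f i:]"
  by (induction I rule: infinite_finite_induct) (simp_all add: one_pCons mult.commute)

text \<open>
  The Leibniz formula, sorted by powers of the indeterminate. Both the functional \<open>E\<close> and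
  the operator \<open>E0\<close> are evaluated on monomials, and this is the form in which
  their values are compared with determinants.
\<close>

lemma det_powers_over_constants:
  fixes b :: "nat \<Rightarrow> nat \<Rightarrow> 'a::comm_ring_1"
  shows "det (mat (Suc n) (Suc n) (\<lambda>(r, c). if r = 0 then monom 1 c else [:b r c:])) =
    (\<Sum>p | p permutes {0..n}. monom (of_int (sign p) * (\<Prod>r = 1..n. b r (p r))) (p 0))"
proof -
  let ?M = "mat (Suc n) (Suc n) (\<lambda>(r, c). if r = 0 then monom 1 c else [:b r c:])"
  have "det ?M = (\<Sum>p | p permutes {0..n}. of_int (sign p) * (\<Prod>r = 0..n. ?M $$ (r, p r)))"
    by (simp add: det_def'[of _ "Suc n"] atLeastLessThanSuc_atLeastAtMost
        del: prod.op_ivl_Suc sum.op_ivl_Suc)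
  also have "\<dots> = (\<Sum>p | p permutes {0..n}.
      monom (of_int (sign p) * (\<Prod>r = 1..n. b r (p r))) (p 0))"
  proof (intro sum.cong refl)
    fix p assume "p \<in> {p. p permutes {0..n}}"
    then have le: "p r \<le> n" if "r \<le> n" for r
      using that permutes_in_image[of p "{0..n}" r] by simp
    have "(\<Prod>r = 0..n. ?M $$ (r, p r)) = ?M $$ (0, p 0) * (\<Prod>r = 1..n. ?M $$ (r, p r))"
      by (simp add: prod.atLeast_Suc_atMost)
    also have "(\<Prod>r = 1..n. ?M $$ (r, p r)) = (\<Prod>r = 1..n. [:b r (p r):])"
      using le by (intro prod.cong refl) (auto simp: less_Suc_eq_le)
    also have "\<dots> = [:\<Prod>r = 1..n. b r (p r):]"
      by (rule prod_const_poly)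
    also have "?M $$ (0, p 0) = monom 1 (p 0)"
      using le[of 0] by simp
    finally show "of_int (sign p) * (\<Prod>r = 0..n. ?M $$ (r, p r)) =
        monom (of_int (sign p) * (\<Prod>r = 1..n. b r (p r))) (p 0)"
      by (simp add: of_int_poly smult_monom mult.commute)
  qed
  finally show ?thesis .
qed

text \<open>
  The determinant is linear in its first row, and the indeterminate occurs only there. So
  multiplying by a power and applying a functional can be done inside that row.
\<close>

lemma linear_functional_det_powers:
  fixes b :: "nat \<Rightarrow> nat \<Rightarrow> 'a::field" and E :: "'a poly \<Rightarrow> 'a"
  assumes E: "Vector_Spaces.linear smult (*) E"
  shows "E (monom 1 k * det (mat (Suc n) (Suc n)
             (\<lambda>(r, c). if r = 0 then monom 1 c else [:b r c:]))) =
    det (mat (Suc n) (Suc n) (\<lambda>(r, c). if r = 0 then E (monom 1 (k + c)) else b r c))"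
proof -
  interpret Vector_Spaces.linear smult "(*)" E by (rule E)
  let ?M = "mat (Suc n) (Suc n) (\<lambda>(r, c). if r = 0 then E (monom 1 (k + c)) else b r c)"
  have "E (monom 1 k * det (mat (Suc n) (Suc n)
             (\<lambda>(r, c). if r = 0 then monom 1 c else [:b r c:]))) =
    (\<Sum>p | p permutes {0..n}.
       E (smult (of_int (sign p) * (\<Prod>r = 1..n. b r (p r))) (monom 1 (k + p 0))))"
    by (simp add: det_powers_over_constants sum_distrib_left sum mult_monom smult_monom)
  also have "\<dots> = (\<Sum>p | p permutes {0..n}. of_int (sign p) * (\<Prod>r = 0..n. ?M $$ (r, p r)))"
  proof (intro sum.cong refl)
    fix p assume "p \<in> {p. p permutes {0..n}}"
    then have le: "p r \<le> n" if "r \<le> n" for r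
      using that permutes_in_image[of p "{0..n}" r] by simp
    have "(\<Prod>r = 0..n. ?M $$ (r, p r)) = ?M $$ (0, p 0) * (\<Prod>r = 1..n. ?M $$ (r, p r))"
      by (simp add: prod.atLeast_Suc_atMost)
    also have "(\<Prod>r = 1..n. ?M $$ (r, p r)) = (\<Prod>r = 1..n. b r (p r))"
      using le by (intro prod.cong refl) (auto simp: less_Suc_eq_le)
    also have "?M $$ (0, p 0) = E (monom 1 (k + p 0))"
      using le[of 0] by simp
    finally have M: "(\<Prod>r = 0..n. ?M $$ (r, p r)) =
        E (monom 1 (k + p 0)) * (\<Prod>r = 1..n. b r (p r))" .
    show "E (smult (of_int (sign p) * (\<Prod>r = 1..n. b r (p r))) (monom 1 (k + p 0))) =
        of_int (sign p) * (\<Prod>r = 0..n. ?M $$ (r, p r))"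
      unfolding scale M by (simp only: mult_ac)
  qed
  also have "\<dots> = det ?M"
    by (simp add: det_def'[of _ "Suc n"] atLeastLessThanSuc_atLeastAtMost
        del: prod.op_ivl_Suc sum.op_ivl_Suc)
  finally show ?thesis .
qed

text \<open>Row \<open>r \<ge> 1\<close> of the moment matrix, with entries in the coefficient ring.\<close>

definition moment_row :: "(nat \<Rightarrow> nat \<Rightarrow> 'a) \<Rightarrow> nat \<Rightarrow> nat \<Rightarrow> nat \<Rightarrow> nat \<Rightarrow> 'a" where
  "moment_row a n m r c = (if r \<le> n - m + 1 then a 1 (r - 1 + c) else a (r - (n - m)) c)"

lemma moment_matrix_eq:
  "moment_matrix a n m =
    mat (Suc n) (Suc n) (\<lambda>(r, c). if r = 0 then monom 1 c else [:moment_row a n m r c:])"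
  by (auto simp: moment_matrix_def moment_row_def intro!: cong_mat)

text \<open>
  For \<open>k \<le> n - m\<close> the functional turns the first row into \<open>a\<^sub>k, a\<^sub>k\<^sub>+\<^sub>1, \<dots>\<close>, which is one of
  the rows of shifted moments already present.
\<close>

lemma det_poly_orthogonal:
  fixes E :: "'a::field poly \<Rightarrow> 'a"
  assumes E: "Vector_Spaces.linear smult (*) E"
    and moments: "\<And>k. E (monom 1 k) = a 1 k"
    and "1 \<le> m" "m \<le> n" "k \<le> n - m"
  shows "E (monom 1 k * det_poly a n m) = 0"
proof -
  let ?M = "mat (Suc n) (Suc n) (\<lambda>(r, c). if r = 0 then a 1 (k + c) else moment_row a n m r c)"
  have "E (monom 1 k * det_poly a n m) = det ?M"
    by (simp add: det_poly_def moment_matrix_eq linear_functional_det_powers[OF E] moments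
        cong: if_cong)
  also have "\<dots> = 0"
  proof (rule det_identical_rows[of _ "Suc n" 0 "k + 1"])
    show "row ?M 0 = row ?M (k + 1)"
      using assms(3-) by (intro eq_vecI) (auto simp: moment_row_def)
  qed (use assms(3-) in auto)
  finally show ?thesis .
qed

section \<open>The operator on monomials\<close>

text \<open>
  Enlarging the set of exponent vectors to a fixed finite superset of the support makes the
  additivity of \<open>E0\<close> visible, as the supports of two summands and of their sum differ.
\<close>

lemma E0_eq_sum:
  assumes "finite S" "Poly_Mapping.keys f \<subseteq> S"
  shows "E0 a cls n f = (\<Sum>e\<in>S.
     monom (Poly_Mapping.lookup f e * (\<Prod>i = 1..n. a (cls i) (Poly_Mapping.lookup e i)))
           (Poly_Mapping.lookup e 0))"
  unfolding E0_def using assms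
  by (intro sum.mono_neutral_left) (auto simp: in_keys_iff)

lemma E0_add: "E0 a cls n (f + g) = E0 a cls n f + E0 a cls n g"
proof -
  let ?S = "Poly_Mapping.keys f \<union> Poly_Mapping.keys g"
  have "Poly_Mapping.keys (f + g) \<subseteq> ?S" by (rule keys_add)
  then show ?thesis
    by (simp add: E0_eq_sum[of ?S] lookup_add distrib_right add_monom[symmetric] sum.distrib)
qed

lemma E0_sum: "E0 a cls n (\<Sum>j\<in>J. f j) = (\<Sum>j\<in>J. E0 a cls n (f j))"
  by (induction J rule: infinite_finite_induct) (simp_all add: E0_add E0_def[of _ _ _ 0])

lemma E0_single:
  "E0 a cls n (Poly_Mapping.single e c) =
    monom (c * (\<Prod>i = 1..n. a (cls i) (Poly_Mapping.lookup e i))) (Poly_Mapping.lookup e 0)"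
  by (simp add: E0_eq_sum[of "{e}"])

lemma prod_indet_power:
  "(\<Prod>i\<in>I. indet i ^ k i :: 'a::comm_ring_1 mpolynomial) =
    Poly_Mapping.single (\<Sum>i\<in>I. Poly_Mapping.single i (k i)) 1"
proof -
  have pow: "(indet i ^ k :: 'a mpolynomial) = Poly_Mapping.single (Poly_Mapping.single i k) 1" for i k
    by (induction k) (simp_all add: indet_def mult_single single_add[symmetric])
  show ?thesis
    by (induction I rule: infinite_finite_induct) (simp_all add: pow mult_single)
qed

lemma lookup_sum_single:
  "finite I \<Longrightarrow> Poly_Mapping.lookup (\<Sum>i\<in>I. Poly_Mapping.single i (k i)) j = (if j \<in> I then k j else 0)"
  by (simp add: lookup_sum lookup_single when_def)

text \<open>
  The value of \<open>E0\<close> on a product of one term from each of the two Vandermonde polynomials.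
  An indeterminate occurring in both factors contributes the moment of the sum of its exponents,
  which is what produces the rows of shifted moments.
\<close>

lemma E0_signed_monomial_product:
  assumes "N \<le> n"
  shows "E0 a cls n (of_int s * (\<Prod>i = 1..N. indet i ^ k i) * (of_int t * (\<Prod>i = 0..n. indet i ^ l i))) =
    monom (of_int s * (of_int t * (\<Prod>i = 1..n. a (cls i) ((if i \<le> N then k i else 0) + l i)))) (l 0)"
proof -
  have *: "of_int s * (\<Prod>i = 1..N. indet i ^ k i) * (of_int t * (\<Prod>i = 0..n. indet i ^ l i)) =
    Poly_Mapping.single ((\<Sum>i = 1..N. Poly_Mapping.single i (k i)) + (\<Sum>i = 0..n. Poly_Mapping.single i (l i)))
      (of_int s * of_int t)"
    unfolding prod_indet_power single_of_int[symmetric] mult_single by simp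
  have "(\<Prod>i = 1..n. a (cls i) ((if i \<in> {1..N} then k i else 0) + (if i \<in> {0..n} then l i else 0))) =
     (\<Prod>i = 1..n. a (cls i) ((if i \<le> N then k i else 0) + l i))"
    by (intro prod.cong) auto
  then show ?thesis
    unfolding * E0_single by (simp add: lookup_add lookup_sum_single mult.assoc)
qed

section \<open>Comparison of the two families\<close>

text \<open>
  Fix a permutation \<open>p\<close> of \<open>{1..N}\<close>, where \<open>N = n - m + 1\<close>, that is, a term of
  \<open>\<Delta>(x\<^sub>1, \<dots>, x\<^sub>N)\<close>. It shifts the moments of \<open>x\<^sub>i\<close> by \<open>p i - 1\<close>, so summing over the terms
  of \<open>\<Delta>(x\<^sub>0, \<dots>, x\<^sub>n)\<close> yields the moment matrix with its rows permuted by \<open>p\<close>. Hence each of the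
  \<open>N!\<close> permutations \<open>p\<close> contributes the same amount \<open>(sign p)\<^sup>2 det_poly a n m\<close>.
\<close>

lemma umbral_poly_eq_fact_smult_det_poly:
  fixes a :: "nat \<Rightarrow> nat \<Rightarrow> 'a::comm_ring_1"
  assumes mn: "1 \<le> m" "m \<le> n"
    and cls1: "\<And>i. 1 \<le> i \<Longrightarrow> i \<le> n - m + 1 \<Longrightarrow> cls i = 1"
    and cls2: "\<And>i. n - m + 2 \<le> i \<Longrightarrow> i \<le> n \<Longrightarrow> cls i = i - (n - m)"
  shows "umbral_poly a cls n m = smult (of_nat (fact (n - m + 1))) (det_poly a n m)"
proof -
  define N where "N = n - m + 1"
  have N: "1 \<le> N" "N \<le> n" using mn by (auto simp: N_def)
  let ?P = "{p. p permutes {1..N}}" and ?Q = "{q. q permutes {0..n}}"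
  have row: "(\<Sum>q\<in>?Q. monom (of_int (sign q) *
        (\<Prod>i = 1..n. a (cls i) ((if i \<le> N then p i - 1 else 0) + q i))) (q 0)) =
      of_int (sign p) * det_poly a n m" if p: "p permutes {1..N}" for p
  proof -
    have p': "p permutes {0..<Suc n}"
      by (rule permutes_subset[OF p]) (use N in auto)
    have p0: "p 0 = 0" using p by (rule permutes_not_in) auto
    have p_in: "1 \<le> p r \<and> p r \<le> N" if "1 \<le> r" "r \<le> N" for r
      using permutes_in_image[OF p, of r] that by simp
    have p_out: "p r = r" if "N < r" for r
      using that by (intro permutes_not_in[OF p]) auto
    \<comment> \<open>For \<open>i \<le> N\<close> the class is \<open>1\<close> and the exponent is shifted; beyond \<open>N\<close> the row is
      fixed by \<open>p\<close> and its class is that of the matrix.\<close>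
    have entry: "a (cls i) ((if i \<le> N then p i - 1 else 0) + c) = moment_row a n m (p i) c"
      if "1 \<le> i" "i \<le> n" for i c
      using that p_in[of i] p_out[of i] cls1[of i] cls2[of i]
      by (auto simp: moment_row_def N_def)
    have "(\<Sum>q\<in>?Q. monom (of_int (sign q) *
        (\<Prod>i = 1..n. a (cls i) ((if i \<le> N then p i - 1 else 0) + q i))) (q 0)) =
      (\<Sum>q\<in>?Q. monom (of_int (sign q) * (\<Prod>i = 1..n. moment_row a n m (p i) (q i))) (q 0))"
      by (simp add: entry)
    also have "\<dots> = det (mat (Suc n) (Suc n)
        (\<lambda>(r, c). if r = 0 then monom 1 c else [:moment_row a n m (p r) c:]))"
      by (rule det_powers_over_constants[symmetric])
    also have "mat (Suc n) (Suc n)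
        (\<lambda>(r, c). if r = 0 then monom 1 c else [:moment_row a n m (p r) c:]) =
      mat (Suc n) (Suc n) (\<lambda>(r, c). moment_matrix a n m $$ (p r, c))"
    proof (intro cong_mat refl, clarify)
      fix r c assume rc: "r < Suc n" "c < Suc n"
      have "p r < Suc n" using permutes_in_image[OF p', of r] rc by simp
      moreover have "p r = 0 \<longleftrightarrow> r = 0"
        using p0 permutes_inj[OF p] by (metis injD)
      ultimately show "(if r = 0 then monom 1 c else [:moment_row a n m (p r) c:]) =
          moment_matrix a n m $$ (p r, c)"
        using rc by (simp add: moment_matrix_eq)
    qed
    also have "det \<dots> = of_int (sign p) * det_poly a n m"
      unfolding det_poly_def
      by (rule det_permute_rows[OF _ p']) (simp add: moment_matrix_eq)
    finally show ?thesis .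
  qed
  have "umbral_poly a cls n m = (\<Sum>p\<in>?P. \<Sum>q\<in>?Q.
      E0 a cls n (of_int (sign p) * (\<Prod>i = 1..N. indet i ^ (p i - 1)) *
        (of_int (sign q) * (\<Prod>i = 0..n. indet i ^ q i))))"
    unfolding umbral_poly_def N_def[symmetric] vandermonde_expansion[OF N(1)]
      vandermonde_expansion[OF le0] sum_product E0_sum by simp
  also have "\<dots> = (\<Sum>p\<in>?P. of_int (sign p) * (\<Sum>q\<in>?Q. monom (of_int (sign q) *
        (\<Prod>i = 1..n. a (cls i) ((if i \<le> N then p i - 1 else 0) + q i))) (q 0)))"
    by (simp only: E0_signed_monomial_product[OF N(2)])
       (simp add: sum_distrib_left of_int_poly smult_monom)
  also have "\<dots> = (\<Sum>p\<in>?P. det_poly a n m)"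
  proof (intro sum.cong refl)
    fix p assume "p \<in> ?P"
    then have p: "p permutes {1..N}" by simp
    \<comment> \<open>The sign of the term of the small Vandermonde polynomial and the sign of the row
      permutation multiply to \<open>1\<close>: this is why the \<open>N!\<close> terms add up.\<close>
    show "of_int (sign p) * (\<Sum>q\<in>?Q. monom (of_int (sign q) *
        (\<Prod>i = 1..n. a (cls i) ((if i \<le> N then p i - 1 else 0) + q i))) (q 0)) =
      det_poly a n m"
      unfolding row[OF p]
      by (simp add: mult.assoc[symmetric] of_int_mult[symmetric] del: of_int_mult)
  qed
  also have "\<dots> = smult (of_nat (fact N)) (det_poly a n m)"
    by (simp add: card_permutations of_nat_poly)
  finally show ?thesis by (simp add: N_def)
qed

theorem theorem5:
  fixes a :: "nat \<Rightarrow> nat \<Rightarrow> 'a::field_char_0"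
    and E :: "'a poly \<Rightarrow> 'a"
    and cls :: "nat \<Rightarrow> nat \<Rightarrow> nat \<Rightarrow> nat"
  assumes "\<And>k. a 0 k = a 1 k"
    and "a 1 0 \<noteq> 0"
    and "Vector_Spaces.linear smult (*) E"
    and "\<And>k. E (monom 1 k) = a 1 k"
    and "\<And>n m i. 1 \<le> m \<Longrightarrow> m \<le> n \<Longrightarrow> 1 \<le> i \<Longrightarrow> i \<le> n - m + 1 \<Longrightarrow> cls n m i = 1"
    and "\<And>n m i. 1 \<le> m \<Longrightarrow> m \<le> n \<Longrightarrow> n - m + 2 \<le> i \<Longrightarrow> i \<le> n \<Longrightarrow> cls n m i = i - (n - m)"
  shows "((\<forall>n m. 1 \<le> m \<and> m \<le> n \<longrightarrow> degree (det_poly a n m) = n)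
            \<longrightarrow> gen_orthogonal_system E (det_poly a))
       \<and> ((\<forall>n m. 1 \<le> m \<and> m \<le> n \<longrightarrow> degree (umbral_poly a (cls n m) n m) = n)
            \<longrightarrow> gen_orthogonal_system E (\<lambda>n m. umbral_poly a (cls n m) n m))
       \<and> (\<forall>n m. 1 \<le> m \<and> m \<le> n
            \<longrightarrow> (\<exists>c. c \<noteq> 0 \<and> umbral_poly a (cls n m) n m = smult c (det_poly a n m)))"
proof -
  interpret Vector_Spaces.linear smult "(*)" E by (rule assms(3))
  have umbral: "umbral_poly a (cls n m) n m = smult (of_nat (fact (n - m + 1))) (det_poly a n m)"
    if "1 \<le> m" "m \<le> n" for n m
    by (rule umbral_poly_eq_fact_smult_det_poly[OF that]) (use assms(5,6) that in auto)
  have det: "E (monom 1 k * det_poly a n m) = 0" if "1 \<le> m" "m \<le> n" "k \<le> n - m" for n m k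
    by (rule det_poly_orthogonal[of E a, OF assms(3,4) that])
  have umb: "E (monom 1 k * umbral_poly a (cls n m) n m) = 0"
    if "1 \<le> m" "m \<le> n" "k \<le> n - m" for n m k
    using det[OF that] by (simp only: umbral[OF that(1,2)] mult_smult_right scale) simp
  have "E 1 \<noteq> 0"
    using assms(2) assms(4)[of 0] by (simp add: monom_0 one_pCons)
  moreover have "(of_nat (fact (n - m + 1)) :: 'a) \<noteq> 0" for n m :: nat
    unfolding of_nat_eq_0_iff by (rule fact_nonzero)
  ultimately show ?thesis
    unfolding gen_orthogonal_system_def
    using assms(3) det umb umbral by blast
qed

end
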